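(* For a compact Hausdorff flow $(X,T)$, every point of $X$ is almost automorphic if and only if the enveloping semigroup $\mathcal E(X,T)$ is a compact Hausdorff topological group in the topology of pointwise convergence in $X^X$.
   Context: $X$ compact Hausdorff, $T$ a topological group acting continuously on $X$. A point $x$ is almost automorphic if for every net $\{t_i\}\subset T$ with $t_ix\to y$ it holds that $t_i^{-1}y\to x$. The enveloping semigroup $\mathcal E(X,T)$ is the closure of $T$ in $X^X$ with the product topology, with composition as operation. *)

theory Defs
  imports "HOL-Analysis.Analysis" "HOL-Algebra.Group"
begin

definition topological_group :: "('a, 'b) monoid_scheme \<Rightarrow> 'a topology \<Rightarrow> bool" where
  "topological_group G \<tau> \<longleftrightarrow>
     group G \<and> topspace \<tau> = carrier G \<and>
     continuous_map (prod_topology \<tau> \<tau>) \<tau> (\<lambda>(a, b). a \<otimes>\<^bsub>G\<^esub> b) \<and>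
     continuous_map \<tau> \<tau> (\<lambda>a. inv\<^bsub>G\<^esub> a)"

definition continuous_action ::
    "('g, 'b) monoid_scheme \<Rightarrow> 'g topology \<Rightarrow> ('g \<Rightarrow> 'x::topological_space \<Rightarrow> 'x) \<Rightarrow> bool" where
  "continuous_action G \<tau> act \<longleftrightarrow>
     topological_group G \<tau> \<and>
     (\<forall>x. act \<one>\<^bsub>G\<^esub> x = x) \<and>
     (\<forall>g\<in>carrier G. \<forall>h\<in>carrier G. \<forall>x. act (g \<otimes>\<^bsub>G\<^esub> h) x = act g (act h x)) \<and>
     continuous_map (prod_topology \<tau> euclidean) euclidean (\<lambda>(g, x). act g x)"

text \<open>Almost automorphic point. A net (t_i) in T is represented by the filter
  it induces on T (the image of the index filter); convergence of t_i x and
  of t_i^{-1} y depends only on that filter.\<close>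
definition almost_automorphic ::
    "('g, 'b) monoid_scheme \<Rightarrow> ('g \<Rightarrow> 'x::topological_space \<Rightarrow> 'x) \<Rightarrow> 'x \<Rightarrow> bool" where
  "almost_automorphic G act x \<longleftrightarrow>
     (\<forall>(F::'g filter) y. (\<forall>\<^sub>F t in F. t \<in> carrier G) \<longrightarrow>
        ((\<lambda>t. act t x) \<longlongrightarrow> y) F \<longrightarrow>
        ((\<lambda>t. act (inv\<^bsub>G\<^esub> t) y) \<longlongrightarrow> x) F)"

text \<open>Enveloping semigroup: closure of T (as maps X \<Rightarrow> X) in X^X with the
  product topology (pointwise convergence).\<close>
definition enveloping_semigroup ::
    "('g, 'b) monoid_scheme \<Rightarrow> ('g \<Rightarrow> 'x::topological_space \<Rightarrow> 'x) \<Rightarrow> ('x \<Rightarrow> 'x) set" where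
  "enveloping_semigroup G act = closure ((\<lambda>g. act g) ` carrier G)"

end

theory Submission
  imports Defs
begin

text \<open>If every point is almost automorphic and \<open>t\<^sub>i \<rightarrow> p\<close> in the enveloping semigroup, then every
  cluster point \<open>q\<close> of \<open>t\<^sub>i\<inverse>\<close> satisfies \<open>q \<circ> p = id\<close>. Hence the semigroup is a group and inversion
  is continuous; right translations are always continuous, and conjugating them with inversion shows
  that left translations are continuous as well. Joint continuity of the multiplication is Ellis'
  theorem. It is obtained here from a weak form of Namioka's theorem: for a separately continuous
  real function \<open>f\<close> on a product of compact spaces, the map \<open>x \<mapsto> f(x, \<cdot>)\<close> has small oscillation in
  the sup norm on some nonempty open set; translations carry this set to any given point of the group.

  Conversely, if the enveloping semigroup is a compact topological group and \<open>t\<^sub>i x \<rightarrow> y\<close>, pass to a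
  subnet with \<open>t\<^sub>i \<rightarrow> p\<close>; then \<open>p x = y\<close> and \<open>t\<^sub>i\<inverse> y \<rightarrow> p\<inverse> y = x\<close>.\<close>

section \<open>Separately continuous functions on compact spaces\<close>

text \<open>Filter form of passing to a convergent subnet: compactness gives a cluster point
  \<open>a\<close> of the image of \<open>F\<close>, and \<open>F\<close> is refined by the
  preimages of the neighbourhoods of \<open>a\<close>.\<close>

lemma compact_subfilter_tendsto:
  assumes "compact A" "F \<noteq> bot" "\<forall>\<^sub>F i in F. u i \<in> A"
  obtains a H where "a \<in> A" "H \<le> F" "H \<noteq> bot" "(u \<longlongrightarrow> a) H"
proof -
  have "filtermap u F \<noteq> bot" "\<forall>\<^sub>F x in filtermap u F. x \<in> A"
    using assms by (auto simp: filtermap_bot_iff eventually_filtermap)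
  then obtain a where a: "a \<in> A" "inf (nhds a) (filtermap u F) \<noteq> bot"
    using assms(1) unfolding compact_filter by blast
  let ?H = "inf F (filtercomap u (nhds a))"
  have "?H \<noteq> bot"
  proof
    assume "?H = bot"
    then have "eventually (\<lambda>_. False) ?H" by simp
    then obtain P Q where PQ: "eventually P F" "eventually Q (filtercomap u (nhds a))"
        "\<And>i. P i \<Longrightarrow> Q i \<Longrightarrow> False"
      unfolding eventually_inf by blast
    from PQ(2) obtain R where R: "eventually R (nhds a)" "\<And>i. R (u i) \<Longrightarrow> Q i"
      unfolding eventually_filtercomap by blast
    have "\<forall>\<^sub>F x in filtermap u F. \<not> R x"
      unfolding eventually_filtermap using PQ(1) by eventually_elim (use PQ(3) R(2) in blast)
    then have "eventually (\<lambda>_. False) (inf (nhds a) (filtermap u F))"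
      unfolding eventually_inf using R(1) by blast
    then show False using a(2) by (simp add: trivial_limit_def)
  qed
  moreover have "(u \<longlongrightarrow> a) ?H"
    by (rule filterlim_mono[OF filterlim_filtercomap order_refl inf_le2])
  ultimately show thesis using that a(1) by (meson inf_le1)
qed

lemma continuous_on_sublevel_open:
  fixes g :: "'a::topological_space \<Rightarrow> real"
  assumes "continuous_on A g"
  shows "\<exists>W. open W \<and> (\<forall>x\<in>A. x \<in> W \<longleftrightarrow> g x < c)"
proof -
  obtain W where "open W" "W \<inter> A = g -` {..<c} \<inter> A"
    using assms unfolding continuous_on_open_invariant by (meson open_lessThan)
  then show ?thesis by blast
qed

text \<open>If there were no such pair, points of \<open>B\<close> that \<open>P\<close> separates
  by less than \<delta> would be separated by at most \<epsilon>/4 by every \<open>f x\<close> with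
  \<open>x\<close> in \<open>U \<inter> A\<close>. Finitely many \<open>W z\<close> cover
  \<open>B\<close>, so such an \<open>f x\<close> is known up to \<epsilon>/4 from its values on a
  finite set \<open>Z\<close>. Near \<open>x0\<close> these values move by less than \<epsilon>/4,
  so \<open>f x\<close> stays within 3\<epsilon>/4 of \<open>f x0\<close> on all of
  \<open>B\<close>, against \<open>large\<close>.\<close>

lemma separately_continuous_separating_pair:
  fixes f :: "'a::topological_space \<Rightarrow> 'b::topological_space \<Rightarrow> real"
  assumes B: "compact B"
    and f1: "\<And>y. y \<in> B \<Longrightarrow> continuous_on A (\<lambda>x. f x y)"
    and f2: "\<And>x. x \<in> A \<Longrightarrow> continuous_on B (f x)"
    and large: "\<And>U x0. open U \<Longrightarrow> x0 \<in> U \<inter> A \<Longrightarrow> \<exists>x\<in>U \<inter> A. \<exists>y\<in>B. \<bar>f x y - f x0 y\<bar> > \<epsilon>"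
    and "\<epsilon> > 0" "\<delta> > 0" "open U" "U \<inter> A \<noteq> {}" "finite P" "P \<subseteq> A"
  obtains x y y' where "x \<in> U \<inter> A" "y \<in> B" "y' \<in> B"
    "(\<Sum>a\<in>P. \<bar>f a y - f a y'\<bar>) < \<delta>" "f x y - f x y' > \<epsilon> / 4"
proof (rule ccontr)
  note witness = that
  assume "\<not> thesis"
  then have close: "f x y - f x y' \<le> \<epsilon> / 4"
    if "x \<in> U \<inter> A" "y \<in> B" "y' \<in> B" "(\<Sum>a\<in>P. \<bar>f a y - f a y'\<bar>) < \<delta>" for x y y'
    using that witness \<open>\<not> thesis\<close> by (meson not_le)
  have "\<exists>W. open W \<and> (\<forall>y\<in>B. y \<in> W \<longleftrightarrow> (\<Sum>a\<in>P. \<bar>f a y - f a z\<bar>) < \<delta>)" for z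
  proof -
    have "continuous_on B (\<lambda>y. \<Sum>a\<in>P. \<bar>f a y - f a z\<bar>)"
      using f2 \<open>P \<subseteq> A\<close> by (intro continuous_intros) auto
    then show ?thesis by (rule continuous_on_sublevel_open)
  qed
  then obtain W where W: "\<And>z. open (W z)"
      "\<And>z y. y \<in> B \<Longrightarrow> y \<in> W z \<longleftrightarrow> (\<Sum>a\<in>P. \<bar>f a y - f a z\<bar>) < \<delta>"
    by metis
  have "B \<subseteq> (\<Union>z\<in>B. W z)" using W(2) \<open>\<delta> > 0\<close> by fastforce
  then obtain Z where Z: "Z \<subseteq> B" "finite Z" "B \<subseteq> (\<Union>z\<in>Z. W z)"
    using compactE_image[OF B] W(1) by metis
  obtain x0 where x0: "x0 \<in> U \<inter> A" using assms by blast
  have cont: "continuous_on A (\<lambda>x. \<Sum>z\<in>Z. \<bar>f x z - f x0 z\<bar>)"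
    using f1 Z(1) by (intro continuous_intros) auto
  obtain V where V: "open V" "\<And>x. x \<in> A \<Longrightarrow> x \<in> V \<longleftrightarrow> (\<Sum>z\<in>Z. \<bar>f x z - f x0 z\<bar>) < \<epsilon> / 4"
    using continuous_on_sublevel_open[OF cont, of "\<epsilon> / 4"] by blast
  have "x0 \<in> (U \<inter> V) \<inter> A" using x0 V(2) \<open>\<epsilon> > 0\<close> by simp
  then obtain x y where xy: "x \<in> U \<inter> V \<inter> A" "y \<in> B" "\<bar>f x y - f x0 y\<bar> > \<epsilon>"
    using large[of "U \<inter> V" x0] V(1) \<open>open U\<close> by auto
  obtain z where z: "z \<in> Z" "y \<in> W z" using Z(3) xy(2) by blast
  have yz: "(\<Sum>a\<in>P. \<bar>f a y - f a z\<bar>) < \<delta>" "(\<Sum>a\<in>P. \<bar>f a z - f a y\<bar>) < \<delta>"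
    using z W(2) xy(2) by (auto simp: abs_minus_commute)
  have "\<bar>f x z - f x0 z\<bar> \<le> (\<Sum>z\<in>Z. \<bar>f x z - f x0 z\<bar>)"
    using Z(2) z(1) by (intro member_le_sum) auto
  also have "\<dots> < \<epsilon> / 4" using V(2) xy(1) by blast
  finally have "\<bar>f x z - f x0 z\<bar> < \<epsilon> / 4" .
  moreover have "\<bar>f x' y - f x' z\<bar> \<le> \<epsilon> / 4" if "x' \<in> U \<inter> A" for x'
  proof -
    have "z \<in> B" using z(1) Z(1) by blast
    then show ?thesis
      using close[OF that xy(2) _ yz(1)] close[OF that _ xy(2) yz(2)] by linarith
  qed
  then have "\<bar>f x y - f x z\<bar> \<le> \<epsilon> / 4" "\<bar>f x0 y - f x0 z\<bar> \<le> \<epsilon> / 4"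
    using xy(1) x0 by auto
  ultimately show False using xy(3) \<open>\<epsilon> > 0\<close> by linarith
qed

text \<open>Otherwise one finds pairs \<open>y\<^sub>n, y'\<^sub>n\<close> that the functions \<open>f(x\<^sub>k, \<cdot>)\<close>, \<open>k < n\<close>, separate less and
  less, although all \<open>f(x, \<cdot>)\<close> with \<open>x\<close> in a decreasing sequence of open sets \<open>U\<^sub>n \<ni> x\<^sub>n\<close> separate them
  by \<open>\<epsilon>/4\<close>. A cluster point of the \<open>x\<^sub>n\<close> and one of the pairs contradict each other.\<close>
lemma separately_continuous_imp_small_oscillation:
  fixes f :: "'a::topological_space \<Rightarrow> 'b::topological_space \<Rightarrow> real"
  assumes A: "compact A" "A \<noteq> {}" and B: "compact B"
    and f1: "\<And>y. y \<in> B \<Longrightarrow> continuous_on A (\<lambda>x. f x y)"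
    and f2: "\<And>x. x \<in> A \<Longrightarrow> continuous_on B (f x)"
    and "\<epsilon> > 0"
  obtains U x0 where "open U" "x0 \<in> U \<inter> A" "\<And>x y. x \<in> U \<inter> A \<Longrightarrow> y \<in> B \<Longrightarrow> \<bar>f x y - f x0 y\<bar> \<le> \<epsilon>"
proof (rule ccontr)
  note witness = that
  assume "\<not> thesis"
  then have large: "\<exists>x\<in>U \<inter> A. \<exists>y\<in>B. \<bar>f x y - f x0 y\<bar> > \<epsilon>" if "open U" "x0 \<in> U \<inter> A" for U x0
    using that witness \<open>\<not> thesis\<close> by (meson not_le)
  \<comment> \<open>One state of the construction: \<open>P\<close> collects the points chosen so
    far, \<open>x\<close> is the newest of them, and the pair \<open>y, y'\<close> is separated on
    the whole of \<open>U \<inter> A\<close>. \<open>R\<close> couples consecutive states: the new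
    pair is tested against the old \<open>P\<close>.\<close>
  define I where "I = (\<lambda>(P, U, x, y, y'). finite P \<and> P \<subseteq> A \<and> open U \<and> x \<in> U \<inter> A \<and> x \<in> P \<and> y \<in> B \<and> y' \<in> B \<and>
      (\<forall>x\<in>U \<inter> A. f x y - f x y' > \<epsilon> / 4))"
  define R where "R = (\<lambda>n (P, U :: 'a set, x :: 'a, y :: 'b, y' :: 'b) (P', U', x' :: 'a, z, z'). P \<subseteq> P' \<and> U' \<subseteq> U \<and>
      (\<Sum>a\<in>P. \<bar>f a z - f a z'\<bar>) < 1 / real (Suc n))"
  have step: "\<exists>U' x y y'. I (insert x P, U', x, y, y') \<and> U' \<subseteq> U \<and> (\<Sum>a\<in>P. \<bar>f a y - f a y'\<bar>) < \<delta>"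
    if PU: "finite P" "P \<subseteq> A" "open U" "U \<inter> A \<noteq> {}" and \<delta>: "\<delta> > 0" for P U \<delta>
  proof -
    obtain x y y' where xy: "x \<in> U \<inter> A" "y \<in> B" "y' \<in> B"
        "(\<Sum>a\<in>P. \<bar>f a y - f a y'\<bar>) < \<delta>" "f x y - f x y' > \<epsilon> / 4"
      using separately_continuous_separating_pair[OF B f1 f2 large \<open>\<epsilon> > 0\<close> \<delta> PU(3,4,1,2)] by blast
    \<comment> \<open>Separation at \<open>x\<close> is strict, so it persists on a neighbourhood,
      to which \<open>U\<close> is shrunk. The difference is negated to turn the lower bound into a
      sublevel set.\<close>
    have cont: "continuous_on A (\<lambda>x. f x y' - f x y)"
      using f1 xy(2,3) by (intro continuous_intros) auto
    obtain W where W: "open W" "\<And>x. x \<in> A \<Longrightarrow> x \<in> W \<longleftrightarrow> f x y' - f x y < - (\<epsilon> / 4)"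
      using continuous_on_sublevel_open[OF cont, of "- (\<epsilon> / 4)"] by blast
    have "I (insert x P, U \<inter> W, x, y, y')"
      unfolding I_def using PU xy W by fastforce
    then show ?thesis using xy(4) by blast
  qed
  have "\<exists>s. \<forall>n. I (s n) \<and> R n (s n) (s (Suc n))"
  proof (rule dependent_nat_choice)
    show "\<exists>s. I s" using step[of "{}" UNIV 1] A(2) by auto
  next
    fix s n assume "I s"
    then obtain P U x y y' where s: "s = (P, U, x, y, y')" "I (P, U, x, y, y')"
      by (metis prod_cases5)
    then have "finite P" "P \<subseteq> A" "open U" "U \<inter> A \<noteq> {}" unfolding I_def by auto
    from step[OF this, of "1 / real (Suc n)"]
    obtain U' x' z z' where "I (insert x' P, U', x', z, z')" "U' \<subseteq> U"
        "(\<Sum>a\<in>P. \<bar>f a z - f a z'\<bar>) < 1 / real (Suc n)" by auto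
    then show "\<exists>s'. I s' \<and> R n s s'"
      unfolding s R_def by (intro exI[of _ "(insert x' P, U', x', z, z')"]) auto
  qed
  then obtain s where s: "\<And>n. I (s n)" "\<And>n. R n (s n) (s (Suc n))" by blast
  obtain P U x y y' where s_eq: "s n = (P n, U n, x n, y n, y' n)" for n
  proof
    show "s n = (fst (s n), fst (snd (s n)), fst (snd (snd (s n))),
        fst (snd (snd (snd (s n)))), snd (snd (snd (snd (s n)))))" for n by simp
  qed
  have P: "finite (P n)" "P n \<subseteq> A" "x n \<in> P n" and x: "x n \<in> U n" "x n \<in> A"
    and y: "y n \<in> B" "y' n \<in> B" and sep: "\<And>u. u \<in> U n \<inter> A \<Longrightarrow> f u (y n) - f u (y' n) > \<epsilon> / 4" for n
    using s(1)[of n] unfolding s_eq I_def by auto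
  have mono: "P n \<subseteq> P (Suc n)" "U (Suc n) \<subseteq> U n"
    and small: "(\<Sum>a\<in>P n. \<bar>f a (y (Suc n)) - f a (y' (Suc n))\<bar>) < 1 / real (Suc n)" for n
    using s(2)[of n] unfolding s_eq R_def by auto
  have Pm: "P k \<subseteq> P n" and Um: "U n \<subseteq> U k" if "k \<le> n" for k n
    using lift_Suc_mono_le[of P] lift_Suc_antimono_le[of U] mono that by auto
  obtain a H where a: "a \<in> A" and H: "H \<le> sequentially" "H \<noteq> bot" "(x \<longlongrightarrow> a) H"
    using compact_subfilter_tendsto[OF A(1), of sequentially x] x by auto
  have fx: "((\<lambda>k. f (x k) b) \<longlongrightarrow> f a b) H" if "b \<in> B" for b
    using continuous_on_tendsto_compose[OF f1[OF that] H(3) a] x by auto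
  \<comment> \<open>For \<open>k \<ge> n\<close> the point \<open>x k\<close> lies in
    \<open>U n\<close>, so the \<open>n\<close>-th pair stays separated in the limit over
    \<open>k\<close>.\<close>
  have sep_a: "f a (y n) - f a (y' n) \<ge> \<epsilon> / 4" for n
  proof (rule tendsto_lowerbound[OF tendsto_diff[OF fx fx] _ H(2)])
    have "\<forall>\<^sub>F k in sequentially. \<epsilon> / 4 \<le> f (x k) (y n) - f (x k) (y' n)"
      using eventually_ge_at_top[of n]
      by eventually_elim (use sep x Um in \<open>meson Int_iff less_imp_le subsetD\<close>)
    then show "\<forall>\<^sub>F k in H. \<epsilon> / 4 \<le> f (x k) (y n) - f (x k) (y' n)"
      using H(1) filter_leD by blast
  qed (use y in auto)
  obtain c K where c: "c \<in> B \<times> B" and K: "K \<le> sequentially" "K \<noteq> bot" "((\<lambda>n. (y n, y' n)) \<longlongrightarrow> c) K"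
    using compact_subfilter_tendsto[OF compact_Times[OF B B], of sequentially "\<lambda>n. (y n, y' n)"] y
    by auto
  obtain b b' where bb: "c = (b, b')" "b \<in> B" "b' \<in> B" using c by blast
  have yb: "(y \<longlongrightarrow> b) K" "(y' \<longlongrightarrow> b') K"
    using tendsto_fst[OF K(3)] tendsto_snd[OF K(3)] bb(1) by auto
  have fy: "((\<lambda>n. f u (y n) - f u (y' n)) \<longlongrightarrow> f u b - f u b') K" if "u \<in> A" for u
    using continuous_on_tendsto_compose[OF f2[OF that] yb(1) bb(2)]
      continuous_on_tendsto_compose[OF f2[OF that] yb(2) bb(3)] y
    by (auto intro: tendsto_diff)
  \<comment> \<open>For fixed \<open>k\<close>, \<open>x k\<close> belongs to \<open>P n\<close> for
    all \<open>n \<ge> k\<close>, so later pairs are separated ever less by \<open>f (x k)\<close>.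
    Letting \<open>k\<close> vary along \<open>H\<close> then gives \<open>f a b = f a b'\<close>,
    against \<open>sep_a\<close>.\<close>
  have "f (x k) b - f (x k) b' = 0" for k
  proof (rule tendsto_unique[OF K(2) fy[OF x(2)]])
    have "(\<lambda>n. f (x k) (y n) - f (x k) (y' n)) \<longlonglongrightarrow> 0"
    \<comment> \<open>The index is shifted because the pair numbered \<open>Suc n\<close> was chosen
      against \<open>P n\<close>.\<close>
    proof (subst filterlim_sequentially_Suc[symmetric], rule Lim_null_comparison)
      show "(\<lambda>n. 1 / real (Suc n)) \<longlonglongrightarrow> 0"
        using LIMSEQ_inverse_real_of_nat by (simp add: inverse_eq_divide)
      show "\<forall>\<^sub>F n in sequentially.
          norm (f (x k) (y (Suc n)) - f (x k) (y' (Suc n))) \<le> 1 / real (Suc n)"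
        using eventually_ge_at_top[of k]
      proof eventually_elim
        case (elim n)
        have "x k \<in> P n" using P(3) Pm[OF elim] by blast
        then have "\<bar>f (x k) (y (Suc n)) - f (x k) (y' (Suc n))\<bar>
            \<le> (\<Sum>a\<in>P n. \<bar>f a (y (Suc n)) - f a (y' (Suc n))\<bar>)"
          using P(1) by (intro member_le_sum) auto
        then show ?case using small[of n] by simp
      qed
    qed
    then show "((\<lambda>n. f (x k) (y n) - f (x k) (y' n)) \<longlongrightarrow> 0) K"
      using K(1) tendsto_mono by blast
  qed
  then have "((\<lambda>k. 0) \<longlongrightarrow> f a b - f a b') H"
    using tendsto_diff[OF fx fx, OF bb(2,3)] by simp
  then have "f a b - f a b' = 0"
    using tendsto_unique[OF H(2) _ tendsto_const] by blast
  moreover have "f a b - f a b' \<ge> \<epsilon> / 4"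
    by (rule tendsto_lowerbound[OF fy[OF a] always_eventually K(2)]) (use sep_a in blast)
  ultimately show False using \<open>\<epsilon> > 0\<close> by simp
qed

section \<open>Joint continuity of multiplication\<close>

lemma Hausdorff_space_euclidean_t2: "Hausdorff_space (euclidean :: 'a::t2_space topology)"
  unfolding Hausdorff_space_def disjnt_def
proof (intro allI impI)
  fix x y :: 'a
  assume "x \<in> topspace euclidean \<and> y \<in> topspace euclidean \<and> x \<noteq> y"
  then show "\<exists>U V. openin euclidean U \<and> openin euclidean V \<and> x \<in> U \<and> y \<in> V \<and> U \<inter> V = {}"
    using hausdorff[of x y] by simp
qed

text \<open>A compact Hausdorff space is completely regular: take \<phi> equal to 0 at
  \<open>h s\<close> and to 1 off \<open>B\<close>. Oscillation at most 1/2 then keeps nearby values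
  of \<open>h\<close> inside \<open>B\<close>.\<close>

lemma continuous_on_compact_HausdorffI:
  fixes h :: "'a::topological_space \<Rightarrow> 'x::t2_space"
  assumes X: "compact (UNIV :: 'x set)"
    and osc: "\<And>(\<phi>::'x \<Rightarrow> real) s e. continuous_on UNIV \<phi> \<Longrightarrow> s \<in> S \<Longrightarrow> e > 0 \<Longrightarrow>
      \<exists>W. open W \<and> s \<in> W \<and> (\<forall>r\<in>S \<inter> W. \<bar>\<phi> (h r) - \<phi> (h s)\<bar> \<le> e)"
  shows "continuous_on S h"
  unfolding continuous_on_topological
proof (intro ballI allI impI)
  fix s B assume s: "s \<in> S" and B: "open B" "h s \<in> B"
  have cs: "compact_space (euclidean :: 'x topology)"
    using X by (simp add: compact_space_def)
  have "completely_regular_space (euclidean :: 'x topology)"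
    using compact_Hausdorff_or_regular_imp_normal_space[OF cs] Hausdorff_space_euclidean_t2
    by (intro normal_imp_completely_regular_space) auto
  moreover have "closedin euclidean (- B)" "h s \<in> topspace euclidean - (- B)"
    using B by (auto simp: closed_Compl)
  ultimately obtain \<phi> :: "'x \<Rightarrow> real" where \<phi>: "continuous_map euclidean (top_of_set {0..1}) \<phi>"
      "\<phi> (h s) = 0" "\<phi> ` (- B) \<subseteq> {1}"
    unfolding completely_regular_space_def by meson
  have "continuous_on UNIV \<phi>" using \<phi>(1) by (simp add: continuous_map_in_subtopology)
  then obtain W where W: "open W" "s \<in> W" "\<forall>r\<in>S \<inter> W. \<bar>\<phi> (h r) - \<phi> (h s)\<bar> \<le> 1 / 2"
    using osc[of \<phi> s "1 / 2"] s by auto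
  have "h r \<in> B" if "r \<in> S" "r \<in> W" for r
  proof (rule ccontr)
    assume "h r \<notin> B"
    then have "\<phi> (h r) = 1" using \<phi>(3) by auto
    moreover have "\<bar>\<phi> (h r) - \<phi> (h s)\<bar> \<le> 1 / 2" using W(3) that by blast
    ultimately show False using \<phi>(2) by simp
  qed
  then show "\<exists>A. open A \<and> s \<in> A \<and> (\<forall>r\<in>S. r \<in> A \<longrightarrow> h r \<in> B)" using W by blast
qed

lemma continuous_on_comp_right:
  fixes q :: "'a \<Rightarrow> 'b" and S :: "('b \<Rightarrow> 'c::topological_space) set"
  shows "continuous_on S (\<lambda>p. p \<circ> q)"
  by (rule continuous_on_coordinatewise_then_product)
    (simp add: continuous_on_product_then_coordinatewise[OF continuous_on_id])

lemma tendsto_apply: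
  fixes p :: "'a \<Rightarrow> 'b::topological_space"
  assumes "(u \<longlongrightarrow> p) F"
  shows "((\<lambda>i. u i x) \<longlongrightarrow> p x) F"
  using continuous_on_tendsto_compose[OF continuous_on_product_coordinates[of x] assms] by simp

text \<open>The syntax of \<^theory>\<open>HOL-Algebra.Group\<close> hides \<open>inv\<close> for functions.\<close>
abbreviation inverse_fun :: "('a \<Rightarrow> 'b) \<Rightarrow> 'b \<Rightarrow> 'a" where
  "inverse_fun \<equiv> inv_into UNIV"

text \<open>The setting for Ellis' theorem, detached from the action. Among the group operations
  only inversion is assumed continuous, and no continuity of the individual maps is assumed.\<close>

locale function_group =
  fixes E :: "('x::t2_space \<Rightarrow> 'x) set"
  assumes compact_UNIV: "compact (UNIV :: 'x set)"
    and compact_E: "compact E"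
    and id_in: "id \<in> E"
    and comp_in: "p \<in> E \<Longrightarrow> q \<in> E \<Longrightarrow> p \<circ> q \<in> E"
    and bij_E: "p \<in> E \<Longrightarrow> bij p"
    and inv_in: "p \<in> E \<Longrightarrow> inverse_fun p \<in> E"
    and continuous_inv: "continuous_on E inverse_fun"
begin

lemma comp_inv: "p \<in> E \<Longrightarrow> p \<circ> inverse_fun p = id" "p \<in> E \<Longrightarrow> inverse_fun p \<circ> p = id"
  using bij_E by (auto simp: bij_def surj_iff inj_iff)

text \<open>Inversion reverses products, so left translation by \<open>p\<close> is inversion, then
  right translation by \<open>inverse_fun p\<close>, then inversion again.\<close>

lemma continuous_on_comp_left:
  assumes "p \<in> E"
  shows "continuous_on E (\<lambda>q. p \<circ> q)"
proof -
  have "continuous_on E (\<lambda>q. inverse_fun (inverse_fun q \<circ> inverse_fun p))"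
  proof (rule continuous_on_compose2[OF continuous_inv])
    show "continuous_on E (\<lambda>q. inverse_fun q \<circ> inverse_fun p)"
      by (rule continuous_on_compose2[OF continuous_on_comp_right[of UNIV] continuous_inv]) auto
  qed (use assms inv_in comp_in in auto)
  moreover have "inverse_fun (inverse_fun q \<circ> inverse_fun p) = p \<circ> q" if "q \<in> E" for q
    using that assms inv_in bij_E by (simp add: o_inv_distrib inv_inv_eq)
  ultimately show ?thesis by (simp cong: continuous_on_cong)
qed

text \<open>The oscillation lemma, applied to \<open>\<phi> (p (q x))\<close>, controls changes of
  the left factor uniformly in the right one near some \<open>u\<close>. Translation moves this
  control to \<open>p\<close>; changes of the right factor are handled by continuity of left
  translation by \<open>p\<close>.\<close>

lemma continuous_on_comp: "continuous_on (E \<times> E) (\<lambda>(p, q). p \<circ> q)"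
proof (rule continuous_on_coordinatewise_then_product, rule continuous_on_compact_HausdorffI[OF compact_UNIV])
  fix x :: 'x and \<phi> :: "'x \<Rightarrow> real" and s and e :: real
  assume \<phi>: "continuous_on UNIV \<phi>" and "s \<in> E \<times> E" and e: "e > 0"
  then obtain p q where s: "s = (p, q)" and p: "p \<in> E" and q: "q \<in> E" by blast
  have \<phi>_eval: "continuous_on S (\<lambda>p. \<phi> (p z))" for S :: "('x \<Rightarrow> 'x) set" and z
    using continuous_on_compose2[OF \<phi> continuous_on_product_coordinates, of z]
    by (auto intro: continuous_on_subset)
  define f where "f = (\<lambda>(p :: 'x \<Rightarrow> 'x) (q :: 'x \<Rightarrow> 'x). \<phi> (p (q x)))"
  have f2: "continuous_on E (f p)" if "p \<in> E" for p
    using continuous_on_compose2[OF \<phi>_eval[of UNIV x] continuous_on_comp_left[OF that]]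
    by (simp add: f_def)
  have f1: "continuous_on E (\<lambda>p. f p q)" for q
    unfolding f_def by (rule \<phi>_eval)
  obtain U u where U: "open U" "u \<in> U \<inter> E" "\<And>r r'. r \<in> U \<inter> E \<Longrightarrow> r' \<in> E \<Longrightarrow> \<bar>f r r' - f u r'\<bar> \<le> e / 2"
    using separately_continuous_imp_small_oscillation[OF compact_E _ compact_E f1 f2, of "e / 2"]
      id_in e by auto
  \<comment> \<open>Write \<open>p' \<circ> q' = (p' \<circ> p\<inverse> \<circ> u) \<circ> (u\<inverse> \<circ> p \<circ> q')\<close>; the first factor is in \<open>U\<close> when \<open>p'\<close> is near \<open>p\<close>.\<close>
  have "continuous_on UNIV (\<lambda>r. r \<circ> (inverse_fun p \<circ> u))"
    by (rule continuous_on_comp_right)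
  then have "open ((\<lambda>r. r \<circ> (inverse_fun p \<circ> u)) -` U)"
    by (rule open_vimage[OF U(1)])
  moreover have "p \<circ> (inverse_fun p \<circ> u) = u" using comp_inv(1)[OF p] by (simp flip: comp_assoc)
  moreover have cont: "continuous_on E (\<lambda>r. \<bar>f p r - f p q\<bar>)"
    using f2[OF p] by (intro continuous_intros) auto
  obtain V where V: "open V" "\<And>r. r \<in> E \<Longrightarrow> r \<in> V \<longleftrightarrow> \<bar>f p r - f p q\<bar> < e / 2"
    using continuous_on_sublevel_open[OF cont, of "e / 2"] by blast
  let ?W = "((\<lambda>r. r \<circ> (inverse_fun p \<circ> u)) -` U) \<times> V"
  have "\<bar>f p' q' - f p q\<bar> \<le> e" if W: "(p', q') \<in> (E \<times> E) \<inter> ?W" for p' q'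
  proof -
    have in_E: "p' \<circ> (inverse_fun p \<circ> u) \<in> E" "inverse_fun u \<circ> (p \<circ> q') \<in> E"
      using W U(2) p by (auto intro!: comp_in inv_in)
    have "f (p' \<circ> (inverse_fun p \<circ> u)) (inverse_fun u \<circ> (p \<circ> q')) = f p' q'" "f u (inverse_fun u \<circ> (p \<circ> q')) = f p q'"
      using comp_inv[OF p] comp_inv[of u] U(2) by (auto simp: f_def fun_eq_iff)
    \<comment> \<open>Uniformity in the second argument is essential:
      \<open>inverse_fun u \<circ> (p \<circ> q')\<close> ranges over elements not confined to a
      small set chosen beforehand.\<close>
    then have "\<bar>f p' q' - f p q'\<bar> \<le> e / 2"
      using U(3)[of "p' \<circ> (inverse_fun p \<circ> u)" "inverse_fun u \<circ> (p \<circ> q')"] in_E W by auto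
    moreover have "\<bar>f p q' - f p q\<bar> < e / 2" using V(2) W by blast
    ultimately show ?thesis by linarith
  qed
  ultimately show "\<exists>W. open W \<and> s \<in> W \<and>
      (\<forall>r\<in>E \<times> E \<inter> W. \<bar>\<phi> ((case r of (p, q) \<Rightarrow> p \<circ> q) x) - \<phi> ((case s of (p, q) \<Rightarrow> p \<circ> q) x)\<bar> \<le> e)"
    using U(2) V q e s by (intro exI[of _ ?W]) (auto simp: f_def open_Times)
qed

lemma topological_group_function_group:
  "topological_group \<lparr>carrier = E, mult = (\<circ>), one = id\<rparr> (top_of_set E)"
proof -
  let ?M = "\<lparr>carrier = E, mult = (\<circ>), one = id\<rparr>"
  have M: "group ?M"
  proof (rule groupI)
    show "\<exists>q\<in>carrier ?M. q \<otimes>\<^bsub>?M\<^esub> p = \<one>\<^bsub>?M\<^esub>" if "p \<in> carrier ?M" for p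
      using that inv_in comp_inv(2) by auto
  qed (auto simp: id_in comp_in comp_assoc)
  have "inv\<^bsub>?M\<^esub> p = inverse_fun p" if "p \<in> E" for p
    using group.inv_equality[OF M, of "inverse_fun p" p] that inv_in comp_inv by auto
  then have "continuous_map (top_of_set E) (top_of_set E) (\<lambda>p. inv\<^bsub>?M\<^esub> p)"
    using continuous_inv inv_in
    by (auto simp: continuous_map_in_subtopology cong: continuous_on_cong)
  moreover have "continuous_map (prod_topology (top_of_set E) (top_of_set E)) (top_of_set E)
      (\<lambda>(p, q). p \<circ> q)"
    using continuous_on_comp comp_in
    by (auto simp: continuous_map_in_subtopology simp flip: subtopology_Times)
  ultimately show ?thesis
    unfolding topological_group_def using M by simp
qed

end

section \<open>Compact flows\<close>

locale compact_flow =
  fixes G :: "('g, 'b) monoid_scheme" and \<tau> :: "'g topology"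
    and act :: "'g \<Rightarrow> 'x::t2_space \<Rightarrow> 'x"
  assumes compact_UNIV: "compact (UNIV :: 'x set)"
    and continuous_action: "continuous_action G \<tau> act"
begin

abbreviation "E \<equiv> enveloping_semigroup G act"

lemma flow_axioms:
  shows group_G: "group G"
    and topspace_G: "topspace \<tau> = carrier G"
    and act_one: "act \<one>\<^bsub>G\<^esub> = id"
    and act_mult: "g \<in> carrier G \<Longrightarrow> h \<in> carrier G \<Longrightarrow> act (g \<otimes>\<^bsub>G\<^esub> h) = act g \<circ> act h"
    and continuous_map_act: "continuous_map (prod_topology \<tau> euclidean) euclidean (\<lambda>(g, x). act g x)"
proof -
  note action = continuous_action[unfolded continuous_action_def topological_group_def]
  show "group G" "topspace \<tau> = carrier G"
    "continuous_map (prod_topology \<tau> euclidean) euclidean (\<lambda>(g, x). act g x)"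
    by (rule action[THEN conjunct1, THEN conjunct1]
        action[THEN conjunct1, THEN conjunct2, THEN conjunct1]
        action[THEN conjunct2, THEN conjunct2, THEN conjunct2])+
  show "act \<one>\<^bsub>G\<^esub> = id"
    using action[THEN conjunct2, THEN conjunct1] by (intro ext) (simp only: id_apply)
  show "act (g \<otimes>\<^bsub>G\<^esub> h) = act g \<circ> act h" if "g \<in> carrier G" "h \<in> carrier G"
    using action[THEN conjunct2, THEN conjunct2, THEN conjunct1] that
    by (intro ext) (simp only: comp_apply)
qed

lemma act_inv_comp: "g \<in> carrier G \<Longrightarrow> act (inv\<^bsub>G\<^esub> g) \<circ> act g = id"
  using act_mult[of "inv\<^bsub>G\<^esub> g" g] group.inv_closed[OF group_G] group.l_inv[OF group_G] act_one
  by simp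

lemma continuous_act:
  assumes "g \<in> carrier G"
  shows "continuous_on UNIV (act g)"
proof -
  have "continuous_map euclidean (prod_topology \<tau> euclidean) (\<lambda>x. (g, x))"
    using assms topspace_G by (auto intro: continuous_map_pairedI)
  then have "continuous_map euclidean euclidean ((\<lambda>(g, x). act g x) \<circ> (\<lambda>x. (g, x)))"
    using continuous_map_act by (rule continuous_map_compose)
  then show ?thesis by (simp add: comp_def)
qed

section \<open>The enveloping semigroup as a compact semigroup\<close>

lemma act_in_E: "g \<in> carrier G \<Longrightarrow> act g \<in> E"
  unfolding enveloping_semigroup_def by (intro closure_subset[THEN subsetD] imageI)

lemma id_in_E: "id \<in> E"
  using act_in_E[OF monoid.one_closed[OF group.is_monoid[OF group_G]]] unfolding act_one .

lemma compact_E: "compact E"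
proof -
  have "compact_space (euclidean :: ('x \<Rightarrow> 'x) topology)"
    using compact_UNIV
    by (auto simp: compact_space_product_topology compact_space_def[of euclidean]
        simp flip: euclidean_product_topology)
  then have "compact (UNIV :: ('x \<Rightarrow> 'x) set)" by (simp add: compact_space_def)
  then show ?thesis
    using compact_Int_closed[OF _ closed_closure] unfolding enveloping_semigroup_def by fastforce
qed

lemma Hausdorff_E: "Hausdorff_space (top_of_set E)"
proof (rule Hausdorff_space_subtopology)
  show "Hausdorff_space (euclidean :: ('x \<Rightarrow> 'x) topology)"
    unfolding euclidean_product_topology[symmetric] Hausdorff_space_product_topology
    using Hausdorff_space_euclidean_t2 by blast
qed

lemma act_comp_in_E:
  assumes "g \<in> carrier G" "q \<in> E"
  shows "act g \<circ> q \<in> E"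
proof -
  have "continuous_on UNIV (\<lambda>q. act g \<circ> q :: 'x \<Rightarrow> 'x)"
    by (rule continuous_on_coordinatewise_then_product)
      (auto intro: continuous_on_compose2[OF continuous_act[OF assms(1)]])
  then have "continuous_on (closure (act ` carrier G)) (\<lambda>q. act g \<circ> q)"
    using continuous_on_subset by blast
  moreover have "(\<lambda>q. act g \<circ> q) ` (act ` carrier G) \<subseteq> E"
  proof clarify
    fix h assume "h \<in> carrier G"
    then show "act g \<circ> act h \<in> E"
      using act_in_E[OF monoid.m_closed[OF group.is_monoid[OF group_G] assms(1)], of h]
        act_mult[OF assms(1), of h] by simp
  qed
  ultimately show ?thesis
    using image_closure_subset[of "act ` carrier G" "\<lambda>q. act g \<circ> q" E] assms(2)
    by (auto simp: enveloping_semigroup_def)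
qed

text \<open>Closure is taken one factor at a time. With the left factor in the acting group,
  composition is continuous in \<open>q\<close> because \<open>act g\<close> is; afterwards the left
  factor varies, as right composition with any \<open>q\<close> is continuous.\<close>

lemma comp_in_E:
  assumes "p \<in> E" "q \<in> E"
  shows "p \<circ> q \<in> E"
proof -
  have "(\<lambda>p. p \<circ> q) ` (act ` carrier G) \<subseteq> E" using act_comp_in_E assms(2) by auto
  then show ?thesis
    using image_closure_subset[OF continuous_on_comp_right[of _ q], where T = E and S = "act ` carrier G"]
      assms(1)
    by (simp add: enveloping_semigroup_def image_subset_iff)
qed

text \<open>The coarsest filter on the acting group along which \<open>act\<close> tends to
  \<open>p\<close>; it stands for all nets converging to \<open>p\<close> at once.\<close>

definition approach :: "('x \<Rightarrow> 'x) \<Rightarrow> 'g filter" where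
  "approach p = inf (filtercomap act (nhds p)) (principal (carrier G))"

lemma eventually_approach:
  "eventually P (approach p) \<longleftrightarrow> (\<exists>W. open W \<and> p \<in> W \<and> (\<forall>g\<in>carrier G. act g \<in> W \<longrightarrow> P g))"
  unfolding approach_def eventually_inf_principal eventually_filtercomap_nhds
  by (simp only: Ball_def imp_conjL[symmetric] conj_commute)

lemma approach_neq_bot:
  assumes "p \<in> E"
  shows "approach p \<noteq> bot"
proof
  assume "approach p = bot"
  then have "eventually (\<lambda>_. False) (approach p)" by simp
  then obtain W where "open W" "p \<in> W" "\<forall>g\<in>carrier G. act g \<notin> W"
    unfolding eventually_approach by blast
  then show False
    using assms unfolding enveloping_semigroup_def closure_iff_nhds_not_empty by blast
qed

lemma approach_carrier: "\<forall>\<^sub>F g in approach p. g \<in> carrier G"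
  unfolding eventually_approach by (intro exI[of _ UNIV]) auto

lemma tendsto_approach: "(act \<longlongrightarrow> p) (approach p)"
  unfolding approach_def by (rule filterlim_mono[OF filterlim_filtercomap order_refl inf_le1])

section \<open>From almost automorphic points to a topological group\<close>

lemma almost_automorphic_tendsto_inv:
  assumes "\<forall>x. almost_automorphic G act x"
  shows "((\<lambda>g. act (inv\<^bsub>G\<^esub> g) (p x)) \<longlongrightarrow> x) (approach p)"
  \<comment> \<open>The point \<open>y\<close> of the definition is \<open>p x\<close>. Convergence
    holds along the full filter, not just a subnet, which later yields continuity of
    inversion.\<close>
  using assms[unfolded almost_automorphic_def, rule_format, OF approach_carrier
      tendsto_apply[OF tendsto_approach]] .

text \<open>By compactness the inverses converge to some \<open>q\<close> along a finer filter; at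
  \<open>p x\<close> their limit is also \<open>x\<close>, so \<open>q (p x) = x\<close>.\<close>

lemma almost_automorphic_left_inverse:
  assumes "\<forall>x. almost_automorphic G act x" "p \<in> E"
  obtains q where "q \<in> E" "q \<circ> p = id"
proof -
  have "\<forall>\<^sub>F g in approach p. act (inv\<^bsub>G\<^esub> g) \<in> E"
    using approach_carrier by eventually_elim (simp add: act_in_E group.inv_closed[OF group_G])
  then obtain q H where q: "q \<in> E" and H: "H \<le> approach p" "H \<noteq> bot"
      "((\<lambda>g. act (inv\<^bsub>G\<^esub> g)) \<longlongrightarrow> q) H"
    by (rule compact_subfilter_tendsto[OF compact_E approach_neq_bot[OF assms(2)]])
  have "q (p x) = x" for x
    using tendsto_unique[OF H(2) tendsto_apply[OF H(3)]]
      tendsto_mono[OF H(1) almost_automorphic_tendsto_inv[OF assms(1)]] by blast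
  then have "q \<circ> p = id" by auto
  then show thesis by (rule that[OF q])
qed

text \<open>The left inverse \<open>q\<close> has a left inverse \<open>r\<close> of its own, and
  \<open>r = r \<circ> q \<circ> p = p\<close>, so \<open>q\<close> is two-sided.\<close>

lemma almost_automorphic_inv:
  assumes "\<forall>x. almost_automorphic G act x" "p \<in> E"
  shows "bij p" "inverse_fun p \<in> E"
proof -
  obtain q where q: "q \<in> E" "q \<circ> p = id" using almost_automorphic_left_inverse[OF assms] .
  obtain r where r: "r \<circ> q = id" using almost_automorphic_left_inverse[OF assms(1) q(1)] .
  have "r = r \<circ> (q \<circ> p)" using q(2) by simp
  also have "\<dots> = p" using r by (simp flip: comp_assoc)
  finally have pq: "p \<circ> q = id" using r by simp
  show "bij p" using pq q(2) o_bij by blast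
  show "inverse_fun p \<in> E" using inv_unique_comp[OF pq q(2)] q(1) by simp
qed

text \<open>The estimate is first obtained for group elements whose action lies in a neighbourhood
  \<open>W\<close> of \<open>p\<close>. Any \<open>r\<close> in \<open>E \<inter> W\<close> is a
  limit of such elements, and the non-strict bound survives the limit.\<close>

lemma almost_automorphic_continuous_inv:
  assumes "\<forall>x. almost_automorphic G act x"
  shows "continuous_on E inverse_fun"
proof (rule continuous_on_coordinatewise_then_product, rule continuous_on_compact_HausdorffI[OF compact_UNIV])
  fix y :: 'x and \<phi> :: "'x \<Rightarrow> real" and p and e :: real
  assume \<phi>: "continuous_on UNIV \<phi>" and p: "p \<in> E" and e: "e > 0"
  have lim: "((\<lambda>g. \<phi> (act (inv\<^bsub>G\<^esub> g) y)) \<longlongrightarrow> \<phi> (inverse_fun r y)) (approach r)" if "r \<in> E" for r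
  proof -
    \<comment> \<open>Choosing the base point \<open>inverse_fun r y\<close> makes the inverses act
      on the fixed point \<open>y\<close>, whatever \<open>r\<close> is.\<close>
    have "r (inverse_fun r y) = y" using almost_automorphic_inv(1)[OF assms that] by (simp add: bij_is_surj surj_f_inv_f)
    then show ?thesis
      using continuous_on_tendsto_compose[OF \<phi> almost_automorphic_tendsto_inv[OF assms, of r "inverse_fun r y"]]
      by simp
  qed
  have "\<forall>\<^sub>F g in approach p. dist (\<phi> (act (inv\<^bsub>G\<^esub> g) y)) (\<phi> (inverse_fun p y)) < e"
    using tendstoD[OF lim[OF p] e] .
  then obtain W where W: "open W" "p \<in> W"
      "\<And>g. g \<in> carrier G \<Longrightarrow> act g \<in> W \<Longrightarrow> \<bar>\<phi> (act (inv\<^bsub>G\<^esub> g) y) - \<phi> (inverse_fun p y)\<bar> < e"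
    unfolding eventually_approach dist_real_def by blast
  have "\<bar>\<phi> (inverse_fun r y) - \<phi> (inverse_fun p y)\<bar> \<le> e" if "r \<in> E \<inter> W" for r
  proof (rule tendsto_upperbound)
    show "((\<lambda>g. \<bar>\<phi> (act (inv\<^bsub>G\<^esub> g) y) - \<phi> (inverse_fun p y)\<bar>) \<longlongrightarrow> \<bar>\<phi> (inverse_fun r y) - \<phi> (inverse_fun p y)\<bar>) (approach r)"
      using lim that by (intro tendsto_intros) auto
    show "\<forall>\<^sub>F g in approach r. \<bar>\<phi> (act (inv\<^bsub>G\<^esub> g) y) - \<phi> (inverse_fun p y)\<bar> \<le> e"
      unfolding eventually_approach using W that by (intro exI[of _ W]) (auto intro: less_imp_le)
    show "approach r \<noteq> bot" using approach_neq_bot that by blast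
  qed
  then show "\<exists>W. open W \<and> p \<in> W \<and> (\<forall>r\<in>E \<inter> W. \<bar>\<phi> (inverse_fun r y) - \<phi> (inverse_fun p y)\<bar> \<le> e)"
    using W by blast
qed

lemma almost_automorphic_imp_topological_group:
  assumes "\<forall>x. almost_automorphic G act x"
  shows "topological_group \<lparr>carrier = E, mult = (\<circ>), one = id\<rparr> (top_of_set E)"
proof -
  interpret function_group E
  proof
    show "compact (UNIV :: 'x set)" "compact E" "id \<in> E" "continuous_on E inverse_fun"
      by (fact compact_UNIV compact_E id_in_E almost_automorphic_continuous_inv[OF assms])+
    show "p \<circ> q \<in> E" if "p \<in> E" "q \<in> E" for p q
      using that by (rule comp_in_E)
    show "bij p" "inverse_fun p \<in> E" if "p \<in> E" for p
      using almost_automorphic_inv[OF assms that] .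
  qed
  show ?thesis by (rule topological_group_function_group)
qed

section \<open>From a topological group to almost automorphic points\<close>

lemma topological_group_imp_almost_automorphic:
  assumes "topological_group \<lparr>carrier = E, mult = (\<circ>), one = id\<rparr> (top_of_set E)"
  shows "almost_automorphic G act x"
  unfolding almost_automorphic_def
proof (intro allI impI)
  fix F y
  assume F: "\<forall>\<^sub>F t in F. t \<in> carrier G" and y: "((\<lambda>t. act t x) \<longlongrightarrow> y) F"
  let ?M = "\<lparr>carrier = E, mult = (\<circ>), one = id\<rparr>"
  have M: "group ?M" and "continuous_map (top_of_set E) (top_of_set E) (\<lambda>p. inv\<^bsub>?M\<^esub> p)"
    using assms unfolding topological_group_def by blast+
  then have cont: "continuous_on E (\<lambda>p. inv\<^bsub>?M\<^esub> p)"
    by (simp add: continuous_map_in_subtopology)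
  have inv_act: "inv\<^bsub>?M\<^esub> (act t) = act (inv\<^bsub>G\<^esub> t)" if "t \<in> carrier G" for t
    using group.inv_equality[OF M, of "act (inv\<^bsub>G\<^esub> t)" "act t"] that
    by (simp add: act_in_E act_inv_comp group.inv_closed[OF group_G])
  show "((\<lambda>t. act (inv\<^bsub>G\<^esub> t) y) \<longlongrightarrow> x) F"
  proof (rule topological_tendstoI, rule ccontr)
    fix U assume U: "open U" "x \<in> U" and "\<not> (\<forall>\<^sub>F t in F. act (inv\<^bsub>G\<^esub> t) y \<in> U)"
    \<comment> \<open>Restricting \<open>F\<close> to the elements that violate convergence keeps it
      proper, so the convergent subfilter found below consists of violations.\<close>
    then have "inf F (principal {t. act (inv\<^bsub>G\<^esub> t) y \<notin> U}) \<noteq> bot" (is "?F' \<noteq> _")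
      by (simp add: trivial_limit_def eventually_inf_principal)
    moreover have F': "\<forall>\<^sub>F t in ?F'. t \<in> carrier G"
      using F filter_leD[OF inf_le1] by blast
    then have "\<forall>\<^sub>F t in ?F'. act t \<in> E" by eventually_elim (rule act_in_E)
    ultimately obtain p H where p: "p \<in> E" and H: "H \<le> ?F'" "H \<noteq> bot" "(act \<longlongrightarrow> p) H"
      using compact_subfilter_tendsto[OF compact_E] by blast
    have HG: "\<forall>\<^sub>F t in H. t \<in> carrier G" using F' H(1) filter_leD by blast
    have "H \<le> F" using H(1) by simp
    then have "p x = y"
      using tendsto_unique[OF H(2) tendsto_apply[OF H(3)]] tendsto_mono[OF _ y] by blast
    have "\<forall>\<^sub>F t in H. act t \<in> E" using HG by eventually_elim (rule act_in_E)
    then have "((\<lambda>t. inv\<^bsub>?M\<^esub> (act t)) \<longlongrightarrow> inv\<^bsub>?M\<^esub> p) H"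
      by (rule continuous_on_tendsto_compose[OF cont H(3) p])
    then have "((\<lambda>t. (inv\<^bsub>?M\<^esub> (act t)) y) \<longlongrightarrow> (inv\<^bsub>?M\<^esub> p) y) H"
      by (rule tendsto_apply)
    moreover have "inv\<^bsub>?M\<^esub> p \<circ> p = id" using group.l_inv[OF M, of p] p by simp
    then have "(inv\<^bsub>?M\<^esub> p) y = x" using \<open>p x = y\<close> by (metis comp_apply id_apply)
    ultimately have "\<forall>\<^sub>F t in H. (inv\<^bsub>?M\<^esub> (act t)) y \<in> U"
      using U topological_tendstoD by fastforce
    moreover have "\<forall>\<^sub>F t in H. act (inv\<^bsub>G\<^esub> t) y \<notin> U"
      using H(1) by (simp add: le_principal)
    ultimately have "\<forall>\<^sub>F t in H. False"
      using HG by eventually_elim (simp add: inv_act)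
    then show False using H(2) by (simp add: trivial_limit_def)
  qed
qed

end

theorem mainTheorem4:
  fixes G :: "('g, 'b) monoid_scheme" and \<tau> :: "'g topology"
    and act :: "'g \<Rightarrow> 'x::t2_space \<Rightarrow> 'x"
  assumes "compact (UNIV :: 'x set)"
    and "continuous_action G \<tau> act"
  shows "(\<forall>x. almost_automorphic G act x) \<longleftrightarrow>
         (compact (enveloping_semigroup G act) \<and>
          Hausdorff_space (subtopology euclidean (enveloping_semigroup G act)) \<and>
          topological_group
            \<lparr>carrier = enveloping_semigroup G act, mult = (\<circ>), one = id\<rparr>
            (subtopology euclidean (enveloping_semigroup G act)))"
proof -
  interpret compact_flow G \<tau> act
    using assms by unfold_locales
  show ?thesis
    using compact_E Hausdorff_E almost_automorphic_imp_topological_group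
      topological_group_imp_almost_automorphic by blast
qed

end
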